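(* Let $n\ge 1$, let $A=(a_{ij})$ be a symmetric real $n\times n$ monotone anti-Monge matrix, and let $B=(b_{ij})$ be an $n\times n$ multi-cut matrix in normal form. Then the identity permutation solves the QAP with matrices $A$ and $B$ to optimality, i.e. for every permutation $\pi$ of $\{1,\ldots,n\}$, $$\sum_{i=1}^n\sum_{j=1}^n a_{ij}\,b_{ij}\ \le\ \sum_{i=1}^n\sum_{j=1}^n a_{\pi(i)\pi(j)}\,b_{ij}.$$
   Context: All matrices are symmetric with real entries. QAP: given $n\times n$ matrices $A=(a_{ij})$ and $B=(b_{ij})$, minimize $Z_\pi(A,B)=\sum_{i=1}^n\sum_{j=1}^n a_{\pi(i)\pi(j)}b_{ij}$ over all permutations $\pi$ of $\{1,\ldots,n\}$. Monotone matrix: $a_{ij}\le a_{i,j+1}$ and $a_{ij}\le a_{i+1,j}$ for all $i,j$ (entries non-decreasing along every row and every column). Anti-Monge matrix: all entries are non-negative and $a_{ij}+a_{rs}\ge a_{is}+a_{rj}$ for all $1\le i<r\le n$ and $1\le j<s\le n$. A monotone anti-Monge matrix is a matrix that is both monotone and anti-Monge. Block matrix: for a $q\times q$ matrix $P=(p_{k\ell})$, an $n\times n$ matrix $B=(b_{ij})$ is a block matrix with block pattern $P$ if there is a partition of $\{1,\ldots,n\}$ into $q$ (possibly empty) intervals $I_1,\ldots,I_q$, with all elements of $I_k$ smaller than all elements of $I_{k+1}$ for $1\le k\le q-1$, such that $b_{ij}=p_{k\ell}$ whenever $i\in I_k$ and $j\in I_\ell$. Multi-cut matrix: a block matrix whose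 pattern has $0$'s on the main diagonal and $1$'s everywhere else (any number $q$ of blocks). It is in normal form if its block sizes satisfy $|I_1|\le|I_2|\le\cdots\le|I_q|$. *)

theory Defs
  imports "Jordan_Normal_Form.Matrix" "HOL-Combinatorics.Permutations"
begin

text \<open>An $n \times n$ matrix is an element of \<^term>\<open>carrier_mat n n\<close>, so rows, columns and
  blocks are indexed from 0: the index set $\{1,\dots,n\}$ becomes \<^term>\<open>{0..<n}\<close>.\<close>

definition monotone_mat :: "real mat \<Rightarrow> bool" where
  "monotone_mat A \<longleftrightarrow>
     (\<forall>i j. i < dim_row A \<longrightarrow> Suc j < dim_col A \<longrightarrow> A $$ (i, j) \<le> A $$ (i, Suc j)) \<and>
     (\<forall>i j. Suc i < dim_row A \<longrightarrow> j < dim_col A \<longrightarrow> A $$ (i, j) \<le> A $$ (Suc i, j))"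

definition anti_Monge_mat :: "real mat \<Rightarrow> bool" where
  "anti_Monge_mat A \<longleftrightarrow>
     (\<forall>i j. i < dim_row A \<longrightarrow> j < dim_col A \<longrightarrow> 0 \<le> A $$ (i, j)) \<and>
     (\<forall>i r j s. i < r \<longrightarrow> r < dim_row A \<longrightarrow> j < s \<longrightarrow> s < dim_col A \<longrightarrow>
        A $$ (i, s) + A $$ (r, j) \<le> A $$ (i, j) + A $$ (r, s))"

text \<open>Blocks may be empty. Only consecutive blocks are compared, which
  constrains nothing across an empty block; when the block sizes are non-decreasing, all empty
  blocks come first, and then all elements of \<open>I k\<close> lie below all elements of \<open>I l\<close> for every
  \<open>k < l\<close>.\<close>

definition interval_partition :: "nat \<Rightarrow> nat \<Rightarrow> (nat \<Rightarrow> nat set) \<Rightarrow> bool" where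
  "interval_partition n q I \<longleftrightarrow>
     (\<forall>k<q. \<exists>a b. I k = {a..<b}) \<and>
     (\<Union>k<q. I k) = {0..<n} \<and>
     (\<forall>k<q. \<forall>l<q. k \<noteq> l \<longrightarrow> I k \<inter> I l = {}) \<and>
     (\<forall>k. Suc k < q \<longrightarrow> (\<forall>i\<in>I k. \<forall>j\<in>I (Suc k). i < j))"

definition block_mat_on :: "real mat \<Rightarrow> (nat \<Rightarrow> nat set) \<Rightarrow> real mat \<Rightarrow> bool" where
  "block_mat_on P I B \<longleftrightarrow>
     square_mat P \<and> square_mat B \<and>
     interval_partition (dim_row B) (dim_row P) I \<and>
     (\<forall>k < dim_row P. \<forall>l < dim_row P. \<forall>i \<in> I k. \<forall>j \<in> I l. B $$ (i, j) = P $$ (k, l))"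

definition multi_cut_pattern :: "nat \<Rightarrow> real mat" where
  "multi_cut_pattern q = mat q q (\<lambda>(k, l). if k = l then 0 else 1)"

definition multi_cut_normal_form :: "real mat \<Rightarrow> bool" where
  "multi_cut_normal_form B \<longleftrightarrow>
     (\<exists>q I. block_mat_on (multi_cut_pattern q) I B \<and>
        (\<forall>k. Suc k < q \<longrightarrow> card (I k) \<le> card (I (Suc k))))"

definition qap_cost :: "real mat \<Rightarrow> real mat \<Rightarrow> (nat \<Rightarrow> nat) \<Rightarrow> real" where
  "qap_cost A B \<pi> =
     (\<Sum>i = 0..<dim_row B. \<Sum>j = 0..<dim_col B. A $$ (\<pi> i, \<pi> j) * B $$ (i, j))"

end

theory Submission
  imports Defs
begin

text \<open>
  Since the entries of a multi-cut matrix are \<open>0\<close> inside the blocks and \<open>1\<close> outside, the cost of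
  \<open>\<pi>\<close> is the sum of all entries of \<open>A\<close>, which does not depend on \<open>\<pi>\<close>, minus the sum over the
  blocks \<open>I\<^sub>k\<close> of the entries \<open>a\<^bsub>\<pi>(i)\<pi>(j)\<^esub>\<close> with \<open>i, j \<in> I\<^sub>k\<close>. So the identity has to maximise
  the latter.

  Border \<open>A\<close> by a zero row and a zero column in front. Non-negativity, monotonicity and the
  anti-Monge inequality together say exactly that all mixed second differences \<open>d\<^bsub>pr\<^esub>\<close> of the
  bordered matrix are non-negative, and \<open>a\<^bsub>ij\<^esub>\<close> is the sum of the \<open>d\<^bsub>pr\<^esub>\<close> with \<open>p \<le> i\<close> and
  \<open>r \<le> j\<close>. Hence \<open>A\<close> is a non-negative combination of products of two threshold functions
  (\<open>within_block_sum\<close>), and it suffices to maximise, for fixed thresholds \<open>p\<close> and \<open>r\<close>, the sum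
  \<open>\<Sum>k. x\<^sub>k y\<^sub>k\<close>, where \<open>x\<^sub>k\<close> and \<open>y\<^sub>k\<close> count the indices in block \<open>k\<close> that \<open>\<pi>\<close> sends to
  values at least \<open>p\<close> and at least \<open>r\<close>.

  The totals of \<open>x\<close> and \<open>y\<close> are fixed, and both vectors are bounded by the vector \<open>s\<close> of block
  sizes. For the identity they are the greedy vectors \<open>x'\<close> and \<open>y'\<close>, which fill the
  blocks to capacity from the last, largest one downwards. Greedy vectors are non-decreasing, because
  \<open>s\<close> is, and their suffix sums are as large as totals and capacities permit. Now
  reorder the blocks by a permutation \<open>\<sigma>\<close> so that \<open>y\<close> becomes non-decreasing. Since \<open>s\<close> is
  sorted, no suffix sum of the reordered vectors exceeds that of the greedy ones. Abel summation
  (\<open>sum_mult_mono_suffix\<close>) then replaces first \<open>x\<close> by \<open>x'\<close>, using that the reordered \<open>y\<close> is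
  non-decreasing, and then \<open>y\<close> by \<open>y'\<close>, using that \<open>x'\<close> is (\<open>sum_mult_le_greedy\<close>).
\<close>

section \<open>Increments and Abel summation\<close>

text \<open>Taking the value before index \<open>0\<close> to be \<open>0\<close> makes \<open>f 0\<close> itself the first increment. For a
  matrix this is the zero border, so that non-negativity and monotonicity become instances of
  the same sign condition as the anti-Monge inequality.\<close>

definition increment :: "(nat \<Rightarrow> real) \<Rightarrow> nat \<Rightarrow> real" where
  "increment f m = f m - (case m of 0 \<Rightarrow> 0 | Suc m' \<Rightarrow> f m')"

lemma sum_increment: "(\<Sum>m\<le>i. increment f m) = f i"
  by (induction i) (simp_all add: increment_def)

lemma eq_sum_thresholds:
  assumes "i < n"
  shows "f i = (\<Sum>m<n. increment f m * of_bool (m \<le> i))"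
proof -
  have "(\<Sum>m<n. increment f m * of_bool (m \<le> i)) = (\<Sum>m\<le>i. increment f m)"
    using assms by (intro sum.mono_neutral_cong_right) auto
  then show ?thesis by (simp add: sum_increment)
qed

lemma increment_nonneg:
  assumes "0 \<le> f 0" and "\<And>k. Suc k < q \<Longrightarrow> f k \<le> f (Suc k)" and "m < q"
  shows "0 \<le> increment f m"
  using assms by (cases m) (auto simp: increment_def)

lemma sum_mult_eq_suffix_sums:
  "(\<Sum>k<q. f k * b k) = (\<Sum>m<q. increment b m * (\<Sum>k\<in>{m..<q}. f k))"
proof -
  have "(\<Sum>k<q. f k * b k) = (\<Sum>k<q. \<Sum>m<q. increment b m * (f k * of_bool (m \<le> k)))"
  proof (rule sum.cong)
    fix k assume "k \<in> {..<q}"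
    then have "b k = (\<Sum>m<q. increment b m * of_bool (m \<le> k))"
      by (intro eq_sum_thresholds) simp
    then have "f k * b k = (\<Sum>m<q. f k * (increment b m * of_bool (m \<le> k)))"
      by (simp only: sum_distrib_left)
    then show "f k * b k = (\<Sum>m<q. increment b m * (f k * of_bool (m \<le> k)))"
      by (simp only: mult.left_commute)
  qed simp
  also have "\<dots> = (\<Sum>m<q. \<Sum>k<q. increment b m * (f k * of_bool (m \<le> k)))"
    by (rule sum.swap)
  also have "\<dots> = (\<Sum>m<q. increment b m * (\<Sum>k\<in>{m..<q}. f k))"
  proof (rule sum.cong)
    fix m assume "m \<in> {..<q}"
    have "(\<Sum>k<q. f k * of_bool (m \<le> k)) = (\<Sum>k\<in>{m..<q}. f k)"
      by (intro sum.mono_neutral_cong_right) auto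
    then show "(\<Sum>k<q. increment b m * (f k * of_bool (m \<le> k))) =
        increment b m * (\<Sum>k\<in>{m..<q}. f k)"
      by (simp flip: sum_distrib_left)
  qed simp
  finally show ?thesis .
qed

text \<open>By Abel summation, a sum weighted with a non-negative non-decreasing \<open>b\<close> is a non-negative
  combination of suffix sums.\<close>

lemma sum_mult_mono_suffix:
  fixes f g b :: "nat \<Rightarrow> real"
  assumes "\<And>k. k < q \<Longrightarrow> 0 \<le> b k" and "\<And>k. Suc k < q \<Longrightarrow> b k \<le> b (Suc k)"
    and suffix: "\<And>m. m < q \<Longrightarrow> (\<Sum>k\<in>{m..<q}. f k) \<le> (\<Sum>k\<in>{m..<q}. g k)"
  shows "(\<Sum>k<q. f k * b k) \<le> (\<Sum>k<q. g k * b k)"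
proof (subst (1 2) sum_mult_eq_suffix_sums, rule sum_mono)
  fix m assume m: "m \<in> {..<q}"
  then have "0 \<le> increment b m"
    using assms(1)[of 0] assms(2) by (intro increment_nonneg[of _ q]) auto
  then show "increment b m * (\<Sum>k\<in>{m..<q}. f k) \<le> increment b m * (\<Sum>k\<in>{m..<q}. g k)"
    using m suffix by (intro mult_left_mono) auto
qed

section \<open>Greedy vectors maximise the sum of products\<close>

lemma sum_le_sum_suffix:
  fixes s :: "nat \<Rightarrow> real"
  assumes mono: "\<And>k l. k \<le> l \<Longrightarrow> l < q \<Longrightarrow> s k \<le> s l"
    and T: "T \<subseteq> {..<q}" "card T = card {m..<q}" and m: "m < q"
  shows "sum s T \<le> sum s {m..<q}"
proof -
  let ?M = "{m..<q}"
  have fin: "finite T" using T(1) by (rule finite_subset) simp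
  have "card (T - ?M) = card (?M - T)"
    using T(2) fin card_Diff_subset_Int[of T ?M] card_Diff_subset_Int[of ?M T]
    by (simp add: Int_commute)
  \<comment> \<open>\<open>s m\<close> separates the values that differ between the two index sets.\<close>
  moreover have "sum s (T - ?M) \<le> real (card (T - ?M)) * s m"
    using T(1) m by (intro sum_bounded_above) (auto intro: mono)
  moreover have "real (card (?M - T)) * s m \<le> sum s (?M - T)"
    by (intro sum_bounded_below) (auto intro: mono)
  ultimately have "sum s (T - ?M) \<le> sum s (?M - T)" by simp
  moreover have "sum s T = sum s (T \<inter> ?M) + sum s (T - ?M)"
    using fin by (rule sum.Int_Diff)
  moreover have "sum s ?M = sum s (T \<inter> ?M) + sum s (?M - T)"
    using sum.Int_Diff[of ?M s T] by (simp add: Int_commute)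
  ultimately show ?thesis by simp
qed

lemma ex_sorting_bij:
  fixes y :: "nat \<Rightarrow> real"
  obtains \<sigma> where "bij_betw \<sigma> {..<q} {..<q}"
    and "\<And>k. Suc k < q \<Longrightarrow> y (\<sigma> k) \<le> y (\<sigma> (Suc k))"
proof -
  define ks where "ks = sort_key y [0..<q]"
  have len: "length ks = q" and "distinct ks" and "set ks = {..<q}"
    by (auto simp: ks_def)
  then have "bij_betw ((!) ks) {..<q} {..<q}"
    by (intro bij_betw_nth) auto
  moreover have "y (ks ! k) \<le> y (ks ! Suc k)" if "Suc k < q" for k
  proof -
    have "sorted (map y ks)" by (simp add: ks_def)
    from sorted_nth_mono[OF this, of k "Suc k"] show ?thesis using that len by simp
  qed
  ultimately show ?thesis by (rule that)
qed

text \<open>Reordering \<open>x\<close> may violate the capacities \<open>s\<close> position by position, but not in a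
  suffix as a whole: a suffix of a sorted \<open>s\<close> carries the largest capacity among all index sets
  of its size.\<close>

lemma reordered_suffix_sum_le:
  fixes x s x' :: "nat \<Rightarrow> real"
  assumes s: "\<And>k l. k \<le> l \<Longrightarrow> l < q \<Longrightarrow> s k \<le> s l"
    and x: "\<And>k. k < q \<Longrightarrow> 0 \<le> x k" "\<And>k. k < q \<Longrightarrow> x k \<le> s k"
    and greedy: "min (\<Sum>k<q. x k) (\<Sum>k\<in>{m..<q}. s k) \<le> (\<Sum>k\<in>{m..<q}. x' k)"
    and \<sigma>: "bij_betw \<sigma> {..<q} {..<q}" and m: "m < q"
  shows "(\<Sum>k\<in>{m..<q}. x (\<sigma> k)) \<le> (\<Sum>k\<in>{m..<q}. x' k)"
proof -
  let ?T = "\<sigma> ` {m..<q}"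
  have inj: "inj_on \<sigma> {m..<q}"
    using \<sigma> by (auto simp: bij_betw_def intro: inj_on_subset)
  have T: "?T \<subseteq> {..<q}" using \<sigma> by (auto simp: bij_betw_def)
  have eq: "(\<Sum>k\<in>{m..<q}. x (\<sigma> k)) = sum x ?T"
    using sum.reindex[OF inj, of x] by simp
  have "sum x ?T \<le> (\<Sum>k<q. x k)"
    using T x(1) by (intro sum_mono2) auto
  moreover have "sum x ?T \<le> sum s ?T"
    using T x(2) by (intro sum_mono) auto
  moreover have "sum s ?T \<le> (\<Sum>k\<in>{m..<q}. s k)"
    using s T card_image[OF inj] m by (intro sum_le_sum_suffix) auto
  ultimately show ?thesis using greedy eq by simp
qed

text \<open>Both vectors are reordered by the same \<open>\<sigma>\<close>, which sorts \<open>y\<close>. Sorting \<open>y\<close> is what permits the first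
  exchange; the second needs only that \<open>x'\<close> is sorted.\<close>

lemma sum_mult_le_greedy:
  fixes x y s x' y' :: "nat \<Rightarrow> real"
  assumes s: "\<And>k l. k \<le> l \<Longrightarrow> l < q \<Longrightarrow> s k \<le> s l"
    and x: "\<And>k. k < q \<Longrightarrow> 0 \<le> x k" "\<And>k. k < q \<Longrightarrow> x k \<le> s k"
    and y: "\<And>k. k < q \<Longrightarrow> 0 \<le> y k" "\<And>k. k < q \<Longrightarrow> y k \<le> s k"
    and x': "\<And>k. k < q \<Longrightarrow> 0 \<le> x' k" "\<And>k. Suc k < q \<Longrightarrow> x' k \<le> x' (Suc k)"
    and greedy_x: "\<And>m. m < q \<Longrightarrow>
      min (\<Sum>k<q. x k) (\<Sum>k\<in>{m..<q}. s k) \<le> (\<Sum>k\<in>{m..<q}. x' k)"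
    and greedy_y: "\<And>m. m < q \<Longrightarrow>
      min (\<Sum>k<q. y k) (\<Sum>k\<in>{m..<q}. s k) \<le> (\<Sum>k\<in>{m..<q}. y' k)"
  shows "(\<Sum>k<q. x k * y k) \<le> (\<Sum>k<q. x' k * y' k)"
proof -
  obtain \<sigma> where \<sigma>: "bij_betw \<sigma> {..<q} {..<q}"
    and sorted: "\<And>k. Suc k < q \<Longrightarrow> y (\<sigma> k) \<le> y (\<sigma> (Suc k))"
    by (rule ex_sorting_bij[of q y]) blast
  have \<sigma>_less: "\<sigma> k < q" if "k < q" for k
    using \<sigma> that by (auto simp: bij_betw_def)
  have "(\<Sum>k<q. x k * y k) = (\<Sum>k<q. x (\<sigma> k) * y (\<sigma> k))"
    using sum.reindex_bij_betw[OF \<sigma>, of "\<lambda>k. x k * y k"] by simp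
  also have "\<dots> \<le> (\<Sum>k<q. x' k * y (\<sigma> k))"
    using y(1) \<sigma>_less sorted reordered_suffix_sum_le[OF s x greedy_x \<sigma>]
    by (intro sum_mult_mono_suffix) auto
  also have "\<dots> = (\<Sum>k<q. y (\<sigma> k) * x' k)" by (simp add: mult.commute)
  also have "\<dots> \<le> (\<Sum>k<q. y' k * x' k)"
    using x' reordered_suffix_sum_le[OF s y greedy_y \<sigma>]
    by (intro sum_mult_mono_suffix) auto
  finally show ?thesis by (simp add: mult.commute)
qed

section \<open>Counting large values block by block\<close>

definition count_ge :: "(nat \<Rightarrow> nat set) \<Rightarrow> (nat \<Rightarrow> nat) \<Rightarrow> nat \<Rightarrow> nat \<Rightarrow> real" where
  "count_ge I \<pi> p k = real (card {i \<in> I k. p \<le> \<pi> i})"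

lemma count_ge_eq_sum: "finite (I k) \<Longrightarrow> count_ge I \<pi> p k = (\<Sum>i\<in>I k. of_bool (p \<le> \<pi> i))"
  unfolding count_ge_def by (simp add: Collect_conj_eq)

lemma count_ge_nonneg: "0 \<le> count_ge I \<pi> p k"
  by (simp add: count_ge_def)

lemma interval_partition_finite: "interval_partition n q I \<Longrightarrow> k < q \<Longrightarrow> finite (I k)"
  by (auto simp: interval_partition_def)

lemma count_ge_le_card:
  "interval_partition n q I \<Longrightarrow> k < q \<Longrightarrow> count_ge I \<pi> p k \<le> real (card (I k))"
  using interval_partition_finite[of n q I k] unfolding count_ge_def
  by (auto intro: card_mono)

lemma sum_interval_partition:
  assumes "interval_partition n q I"
  shows "(\<Sum>i=0..<n. f i) = (\<Sum>k<q. \<Sum>i\<in>I k. f i)"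
proof -
  have "(\<Union>k<q. I k) = {0..<n}" using assms by (simp add: interval_partition_def)
  then have "(\<Sum>i=0..<n. f i) = (\<Sum>i\<in>(\<Union>k<q. I k). f i)" by simp
  also have "\<dots> = (\<Sum>k<q. \<Sum>i\<in>I k. f i)"
    using assms interval_partition_finite[OF assms]
    by (intro sum.UNION_disjoint) (auto simp: interval_partition_def)
  finally show ?thesis .
qed

lemma sum_count_ge:
  assumes "interval_partition n q I" and "\<pi> permutes {0..<n}"
  shows "(\<Sum>k<q. count_ge I \<pi> p k) = (\<Sum>i=0..<n. of_bool (p \<le> i))"
proof -
  have "(\<Sum>k<q. count_ge I \<pi> p k) = (\<Sum>i=0..<n. of_bool (p \<le> \<pi> i))"
    using interval_partition_finite[OF assms(1)]
    by (simp add: sum_interval_partition[OF assms(1)] count_ge_eq_sum)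
  also have "\<dots> = (\<Sum>i=0..<n. of_bool (p \<le> i))"
    using sum.permute[OF assms(2), of "\<lambda>i. of_bool (p \<le> i) :: real"] by (simp add: o_def)
  finally show ?thesis .
qed

lemma le_from_Suc_le:
  fixes f :: "nat \<Rightarrow> nat"
  assumes "\<And>k. Suc k < q \<Longrightarrow> f k \<le> f (Suc k)" and "k \<le> l" "l < q"
  shows "f k \<le> f l"
  using assms(2,3)
proof (induction l rule: dec_induct)
  case (step l)
  then show ?case using assms(1)[of l] by simp
qed simp

text \<open>In an interval partition only consecutive blocks are compared, which says nothing across an
  empty block. With non-decreasing sizes no empty block follows a
  non-empty one, so the comparisons chain.\<close>

lemma blocks_ordered:
  assumes part: "interval_partition n q I"
    and sizes: "\<And>k. Suc k < q \<Longrightarrow> card (I k) \<le> card (I (Suc k))"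
    and "k < l" "l < q" "i \<in> I k" "j \<in> I l"
  shows "i < j"
  using assms(3-)
proof (induction l arbitrary: j)
  case 0
  then show ?case by simp
next
  case (Suc l)
  have consecutive: "i' < j" if "i' \<in> I l" for i'
    using part Suc.prems that by (auto simp: interval_partition_def)
  show ?case
  proof (cases "k = l")
    case True
    then show ?thesis using consecutive Suc.prems by simp
  next
    case False
    have "card (I k) \<le> card (I l)"
    proof (rule le_from_Suc_le[where f = "\<lambda>k. card (I k)" and q = q])
      show "k \<le> l" "l < q" using Suc.prems(1,2) by simp_all
    qed (rule sizes)
    moreover have "card (I k) > 0"
      using Suc.prems interval_partition_finite[OF part, of k] by (auto simp: card_gt_0_iff)
    ultimately obtain i' where "i' \<in> I l"
      by (metis card.empty equals0I not_le)
    moreover have "i < i'"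
      using Suc.IH[OF _ _ _ \<open>i' \<in> I l\<close>] Suc.prems False by simp
    ultimately show ?thesis using consecutive by fastforce
  qed
qed

text \<open>The identity fills the blocks greedily: as soon as some block contains an index that is at
  least \<open>p\<close>, so is every index in every later block.\<close>

lemma count_ge_id_full:
  assumes part: "interval_partition n q I"
    and sizes: "\<And>k. Suc k < q \<Longrightarrow> card (I k) \<le> card (I (Suc k))"
    and "k < l" "l < q" "count_ge I id p k \<noteq> 0"
  shows "count_ge I id p l = real (card (I l))"
proof -
  obtain i where i: "i \<in> I k" "p \<le> i"
    using assms(5) by (auto simp: count_ge_def card_eq_0_iff)
  have "p \<le> j" if "j \<in> I l" for j
    using blocks_ordered[OF part sizes \<open>k < l\<close> \<open>l < q\<close> i(1) that] i(2) by simp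
  then have "{j \<in> I l. p \<le> id j} = I l" by auto
  then show ?thesis by (simp add: count_ge_def)
qed

text \<open>If some block before \<open>m\<close> is reached, the blocks from \<open>m\<close> on are filled to capacity;
  otherwise they contain all the counted indices.\<close>

lemma count_ge_id_suffix:
  assumes part: "interval_partition n q I"
    and sizes: "\<And>k. Suc k < q \<Longrightarrow> card (I k) \<le> card (I (Suc k))"
    and m: "m < q"
  shows "min (\<Sum>k<q. count_ge I id p k) (\<Sum>k\<in>{m..<q}. real (card (I k)))
    \<le> (\<Sum>k\<in>{m..<q}. count_ge I id p k)"
proof (cases "\<exists>k<m. count_ge I id p k \<noteq> 0")
  case True
  then obtain k where "k < m" "count_ge I id p k \<noteq> 0" by blast
  then have "(\<Sum>l\<in>{m..<q}. count_ge I id p l) = (\<Sum>l\<in>{m..<q}. real (card (I l)))"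
    using count_ge_id_full[OF part sizes, of k] by (intro sum.cong) auto
  then show ?thesis by simp
next
  case False
  then have "(\<Sum>k<q. count_ge I id p k) = (\<Sum>k\<in>{m..<q}. count_ge I id p k)"
    by (intro sum.mono_neutral_right) auto
  then show ?thesis by simp
qed

lemma count_ge_id_mono:
  assumes part: "interval_partition n q I"
    and sizes: "\<And>k. Suc k < q \<Longrightarrow> card (I k) \<le> card (I (Suc k))"
    and k: "Suc k < q"
  shows "count_ge I id p k \<le> count_ge I id p (Suc k)"
proof (cases "count_ge I id p k = 0")
  case True
  then show ?thesis by (simp add: count_ge_def)
next
  case False
  then have "count_ge I id p (Suc k) = real (card (I (Suc k)))"
    using k by (intro count_ge_id_full[OF part sizes, of k]) auto
  then show ?thesis
    using count_ge_le_card[OF part, of k id p] sizes[OF k] k by simp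
qed

lemma sum_count_ge_mult_le_id:
  assumes part: "interval_partition n q I"
    and sizes: "\<And>k. Suc k < q \<Longrightarrow> card (I k) \<le> card (I (Suc k))"
    and \<pi>: "\<pi> permutes {0..<n}"
  shows "(\<Sum>k<q. count_ge I \<pi> p k * count_ge I \<pi> r k)
    \<le> (\<Sum>k<q. count_ge I id p k * count_ge I id r k)"
proof (rule sum_mult_le_greedy[where s = "\<lambda>k. real (card (I k))"])
  have total: "(\<Sum>k<q. count_ge I \<pi> t k) = (\<Sum>k<q. count_ge I id t k)" for t
    using sum_count_ge[OF part \<pi>] sum_count_ge[OF part permutes_id] by simp
  show "min (\<Sum>k<q. count_ge I \<pi> p k) (\<Sum>k\<in>{m..<q}. real (card (I k)))
      \<le> (\<Sum>k\<in>{m..<q}. count_ge I id p k)" if "m < q" for m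
    unfolding total using part sizes that by (rule count_ge_id_suffix)
  show "min (\<Sum>k<q. count_ge I \<pi> r k) (\<Sum>k\<in>{m..<q}. real (card (I k)))
      \<le> (\<Sum>k\<in>{m..<q}. count_ge I id r k)" if "m < q" for m
    unfolding total using part sizes that by (rule count_ge_id_suffix)
  show "real (card (I k)) \<le> real (card (I l))" if "k \<le> l" "l < q" for k l
  proof -
    have "card (I k) \<le> card (I l)"
      using sizes that by (rule le_from_Suc_le[where f = "\<lambda>k. card (I k)"])
    then show ?thesis by simp
  qed
  show "count_ge I id p k \<le> count_ge I id p (Suc k)" if "Suc k < q" for k
    using part sizes that by (rule count_ge_id_mono)
qed (auto intro: count_ge_le_card[OF part] count_ge_nonneg)

section \<open>Monotone anti-Monge matrices as sums of threshold products\<close>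

text \<open>This is the difference \<open>a\<^bsub>pr\<^esub> - a\<^bsub>p-1,r\<^esub> - a\<^bsub>p,r-1\<^esub> + a\<^bsub>p-1,r-1\<^esub>\<close> of the zero-bordered matrix.\<close>

definition mixed_increment :: "(nat \<Rightarrow> nat \<Rightarrow> real) \<Rightarrow> nat \<Rightarrow> nat \<Rightarrow> real" where
  "mixed_increment a p r = increment (\<lambda>i. increment (a i) r) p"

lemma mixed_increment_nonneg:
  assumes A: "A \<in> carrier_mat n n" "monotone_mat A" "anti_Monge_mat A" and "p < n" "r < n"
  shows "0 \<le> mixed_increment (\<lambda>i j. A $$ (i, j)) p r"
proof -
  have dims: "dim_row A = n" "dim_col A = n" using A(1) by auto
  have nonneg: "0 \<le> A $$ (i, j)" if "i < n" "j < n" for i j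
    using A(3) that dims by (auto simp: anti_Monge_mat_def)
  have row: "A $$ (i, j) \<le> A $$ (i, Suc j)" if "i < n" "Suc j < n" for i j
    using A(2) that dims by (auto simp: monotone_mat_def)
  have col: "A $$ (i, j) \<le> A $$ (Suc i, j)" if "Suc i < n" "j < n" for i j
    using A(2) that dims by (auto simp: monotone_mat_def)
  have monge: "A $$ (i, Suc j) + A $$ (Suc i, j) \<le> A $$ (i, j) + A $$ (Suc i, Suc j)"
    if "Suc i < n" "Suc j < n" for i j
    using A(3) that dims by (auto simp: anti_Monge_mat_def)
  show ?thesis
    using assms(4,5) nonneg[of 0 0] row[of 0 "r - 1"] col[of "p - 1" 0] monge[of "p - 1" "r - 1"]
    by (cases p; cases r) (auto simp: mixed_increment_def increment_def)
qed

lemma eq_sum_mixed_increments: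
  assumes "i < n" "j < n"
  shows "a i j = (\<Sum>p<n. \<Sum>r<n. mixed_increment a p r * (of_bool (p \<le> i) * of_bool (r \<le> j)))"
proof -
  have "a i j = (\<Sum>r<n. increment (a i) r * of_bool (r \<le> j))"
    using assms(2) by (rule eq_sum_thresholds)
  also have "\<dots> = (\<Sum>r<n. (\<Sum>p<n. mixed_increment a p r * of_bool (p \<le> i)) * of_bool (r \<le> j))"
    unfolding mixed_increment_def
    by (subst eq_sum_thresholds[OF assms(1), where f = "\<lambda>i. increment (a i) _"]) simp
  also have "\<dots> = (\<Sum>r<n. \<Sum>p<n. mixed_increment a p r * (of_bool (p \<le> i) * of_bool (r \<le> j)))"
    by (simp only: sum_distrib_right mult.assoc)
  finally show ?thesis by (subst sum.swap)
qed

text \<open>A product of two threshold functions, summed over a block, is a product of two counts.\<close>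

lemma within_block_sum:
  assumes part: "interval_partition n q I" and \<pi>: "\<pi> permutes {0..<n}"
  shows "(\<Sum>k<q. \<Sum>i\<in>I k. \<Sum>j\<in>I k. a (\<pi> i) (\<pi> j)) =
    (\<Sum>p<n. \<Sum>r<n. mixed_increment a p r * (\<Sum>k<q. count_ge I \<pi> p k * count_ge I \<pi> r k))"
proof -
  have block: "(\<Sum>i\<in>I k. \<Sum>j\<in>I k. a (\<pi> i) (\<pi> j)) =
      (\<Sum>p<n. \<Sum>r<n. mixed_increment a p r * (count_ge I \<pi> p k * count_ge I \<pi> r k))"
    if k: "k < q" for k
  proof -
    have fin: "finite (I k)" using part k by (rule interval_partition_finite)
    have "\<pi> i < n" if "i \<in> I k" for i
    proof -
      have "i \<in> {0..<n}" using part k that by (auto simp: interval_partition_def)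
      then show ?thesis using permutes_in_image[OF \<pi>, of i] by simp
    qed
    then have "(\<Sum>i\<in>I k. \<Sum>j\<in>I k. a (\<pi> i) (\<pi> j)) =
        (\<Sum>i\<in>I k. \<Sum>j\<in>I k. \<Sum>p<n. \<Sum>r<n.
          mixed_increment a p r * (of_bool (p \<le> \<pi> i) * of_bool (r \<le> \<pi> j)))"
      by (intro sum.cong refl eq_sum_mixed_increments)
    also have "\<dots> = (\<Sum>i\<in>I k. \<Sum>p<n. \<Sum>j\<in>I k. \<Sum>r<n.
          mixed_increment a p r * (of_bool (p \<le> \<pi> i) * of_bool (r \<le> \<pi> j)))"
      by (intro sum.cong refl sum.swap)
    also have "\<dots> = (\<Sum>p<n. \<Sum>i\<in>I k. \<Sum>j\<in>I k. \<Sum>r<n.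
          mixed_increment a p r * (of_bool (p \<le> \<pi> i) * of_bool (r \<le> \<pi> j)))"
      by (rule sum.swap)
    also have "\<dots> = (\<Sum>p<n. \<Sum>i\<in>I k. \<Sum>r<n. \<Sum>j\<in>I k.
          mixed_increment a p r * (of_bool (p \<le> \<pi> i) * of_bool (r \<le> \<pi> j)))"
      by (intro sum.cong refl sum.swap)
    also have "\<dots> = (\<Sum>p<n. \<Sum>r<n. \<Sum>i\<in>I k. \<Sum>j\<in>I k.
          mixed_increment a p r * (of_bool (p \<le> \<pi> i) * of_bool (r \<le> \<pi> j)))"
      by (intro sum.cong refl sum.swap)
    also have "\<dots> = (\<Sum>p<n. \<Sum>r<n. mixed_increment a p r *
        ((\<Sum>i\<in>I k. of_bool (p \<le> \<pi> i)) * (\<Sum>j\<in>I k. of_bool (r \<le> \<pi> j))))"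
      unfolding sum_product by (simp only: sum_distrib_left)
    finally show ?thesis using fin by (simp only: count_ge_eq_sum)
  qed
  have "(\<Sum>k<q. \<Sum>i\<in>I k. \<Sum>j\<in>I k. a (\<pi> i) (\<pi> j)) =
      (\<Sum>k<q. \<Sum>p<n. \<Sum>r<n. mixed_increment a p r * (count_ge I \<pi> p k * count_ge I \<pi> r k))"
    using block by simp
  also have "\<dots> = (\<Sum>p<n. \<Sum>k<q. \<Sum>r<n.
      mixed_increment a p r * (count_ge I \<pi> p k * count_ge I \<pi> r k))"
    by (rule sum.swap)
  also have "\<dots> = (\<Sum>p<n. \<Sum>r<n. \<Sum>k<q.
      mixed_increment a p r * (count_ge I \<pi> p k * count_ge I \<pi> r k))"
    by (intro sum.cong refl sum.swap)
  finally show ?thesis by (simp only: sum_distrib_left)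
qed

section \<open>Optimality of the identity\<close>

lemma qap_cost_multi_cut:
  assumes B: "block_mat_on (multi_cut_pattern q) I B" "B \<in> carrier_mat n n"
    and \<pi>: "\<pi> permutes {0..<n}"
  shows "qap_cost A B \<pi> = (\<Sum>i=0..<n. \<Sum>j=0..<n. A $$ (i, j))
    - (\<Sum>k<q. \<Sum>i\<in>I k. \<Sum>j\<in>I k. A $$ (\<pi> i, \<pi> j))"
proof -
  have dims: "dim_row B = n" "dim_col B = n" using B(2) by auto
  have part: "interval_partition n q I"
    and entry: "\<And>k l i j. k < q \<Longrightarrow> l < q \<Longrightarrow> i \<in> I k \<Longrightarrow> j \<in> I l \<Longrightarrow>
      B $$ (i, j) = (if k = l then 0 else 1)"
    using B(1) dims by (auto simp: block_mat_on_def multi_cut_pattern_def)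
  have "qap_cost A B \<pi> =
      (\<Sum>k<q. \<Sum>i\<in>I k. \<Sum>l<q. \<Sum>j\<in>I l. A $$ (\<pi> i, \<pi> j) * B $$ (i, j))"
    by (simp add: qap_cost_def dims sum_interval_partition[OF part])
  also have "\<dots> = (\<Sum>k<q. \<Sum>i\<in>I k. (\<Sum>l<q. \<Sum>j\<in>I l. A $$ (\<pi> i, \<pi> j))
      - (\<Sum>j\<in>I k. A $$ (\<pi> i, \<pi> j)))"
  proof (intro sum.cong refl)
    fix k i assume k: "k \<in> {..<q}" and i: "i \<in> I k"
    have "(\<Sum>l<q. \<Sum>j\<in>I l. A $$ (\<pi> i, \<pi> j) * B $$ (i, j)) =
        (\<Sum>l<q. (\<Sum>j\<in>I l. A $$ (\<pi> i, \<pi> j))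
          - (if l = k then \<Sum>j\<in>I l. A $$ (\<pi> i, \<pi> j) else 0))"
      using k i by (intro sum.cong refl) (auto simp: entry[of k])
    also have "\<dots> = (\<Sum>l<q. \<Sum>j\<in>I l. A $$ (\<pi> i, \<pi> j)) - (\<Sum>j\<in>I k. A $$ (\<pi> i, \<pi> j))"
      using k by (simp add: sum_subtractf)
    finally show "(\<Sum>l<q. \<Sum>j\<in>I l. A $$ (\<pi> i, \<pi> j) * B $$ (i, j)) =
        (\<Sum>l<q. \<Sum>j\<in>I l. A $$ (\<pi> i, \<pi> j)) - (\<Sum>j\<in>I k. A $$ (\<pi> i, \<pi> j))" .
  qed
  also have "\<dots> = (\<Sum>i=0..<n. \<Sum>j=0..<n. A $$ (\<pi> i, \<pi> j))
      - (\<Sum>k<q. \<Sum>i\<in>I k. \<Sum>j\<in>I k. A $$ (\<pi> i, \<pi> j))"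
    by (simp add: sum_interval_partition[OF part] sum_subtractf)
  also have "(\<Sum>i=0..<n. \<Sum>j=0..<n. A $$ (\<pi> i, \<pi> j)) = (\<Sum>i=0..<n. \<Sum>j=0..<n. A $$ (i, j))"
  proof -
    have "(\<Sum>j=0..<n. A $$ (\<pi> i, \<pi> j)) = (\<Sum>j=0..<n. A $$ (\<pi> i, j))" for i
      using sum.permute[OF \<pi>, of "\<lambda>j. A $$ (\<pi> i, j)"] by (simp add: o_def)
    then show ?thesis
      using sum.permute[OF \<pi>, of "\<lambda>i. \<Sum>j=0..<n. A $$ (i, j)"] by (simp add: o_def)
  qed
  finally show ?thesis .
qed

theorem theorem3p4:
  fixes n :: nat and A B :: "real mat"
  assumes "n \<ge> 1"
    and "A \<in> carrier_mat n n" and "B \<in> carrier_mat n n"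
    and "transpose_mat A = A"
    and "monotone_mat A" and "anti_Monge_mat A"
    and "multi_cut_normal_form B"
  shows "\<forall>\<pi>. \<pi> permutes {0..<n} \<longrightarrow> qap_cost A B id \<le> qap_cost A B \<pi>"
proof (intro allI impI)
  fix \<pi> assume \<pi>: "\<pi> permutes {0..<n}"
  obtain q I where block: "block_mat_on (multi_cut_pattern q) I B"
    and sizes: "\<And>k. Suc k < q \<Longrightarrow> card (I k) \<le> card (I (Suc k))"
    using assms(7) by (auto simp: multi_cut_normal_form_def)
  have part: "interval_partition n q I"
    using block assms(3) by (auto simp: block_mat_on_def multi_cut_pattern_def)
  let ?d = "mixed_increment (\<lambda>i j. A $$ (i, j))"
  have "(\<Sum>k<q. \<Sum>i\<in>I k. \<Sum>j\<in>I k. A $$ (\<pi> i, \<pi> j)) =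
      (\<Sum>p<n. \<Sum>r<n. ?d p r * (\<Sum>k<q. count_ge I \<pi> p k * count_ge I \<pi> r k))"
    using part \<pi> by (rule within_block_sum)
  also have "\<dots> \<le> (\<Sum>p<n. \<Sum>r<n. ?d p r * (\<Sum>k<q. count_ge I id p k * count_ge I id r k))"
  proof (rule sum_mono, rule sum_mono, rule mult_left_mono)
    fix p r
    show "(\<Sum>k<q. count_ge I \<pi> p k * count_ge I \<pi> r k)
        \<le> (\<Sum>k<q. count_ge I id p k * count_ge I id r k)"
      using part sizes \<pi> by (rule sum_count_ge_mult_le_id)
    assume "p \<in> {..<n}" "r \<in> {..<n}"
    then show "0 \<le> ?d p r"
      using mixed_increment_nonneg[OF assms(2,5,6)] by simp
  qed
  also have "\<dots> = (\<Sum>k<q. \<Sum>i\<in>I k. \<Sum>j\<in>I k. A $$ (id i, id j))"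
    using part permutes_id by (rule within_block_sum[symmetric])
  finally show "qap_cost A B id \<le> qap_cost A B \<pi>"
    unfolding qap_cost_multi_cut[OF block assms(3) \<pi>]
      qap_cost_multi_cut[OF block assms(3) permutes_id] by simp
qed

end
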